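(* Let $p$ be an odd prime, let $D_{2p}$ be the dihedral group of order $2p$, and let $H$ be a subgroup of $D_{2p}$ of order $2$. Then the number of isotopy classes of normalized right transversals of $H$ in $D_{2p}$ is $$|\mathcal{I}tp(D_{2p},H)|=\frac{P_{Aff(1,p)}(2,\ldots,2)}{2},$$ where $P_{Aff(1,p)}(x_1,\ldots,x_p)$ is the cycle index of the one-dimensional affine group $Aff(1,p)$ acting on $\mathbb{Z}_p$.
   Context: A normalized right transversal (NRT) of a subgroup $H$ in a group $G$ is a subset $S\subseteq G$ with $1\in S$ containing exactly one element of each right coset $Hg$, $g\in G$. It carries the induced operation $\circ$ determined by $\{x\circ y\}=Hxy\cap S$, which makes it a right loop (two-sided identity, and $X\circ a=b$ has a unique solution $X$ for all $a,b$). Two NRTs $S,S'$ with induced operations $\circ,\circ'$ are isotopic if there are bijections $\alpha,\beta,\gamma:S\to S'$ with $\alpha(x)\circ'\beta(y)=\gamma(x\circ y)$ for all $x,y\in S$. $\mathcal{I}tp(G,H)$ denotes the set of isotopy classes of NRTs of $H$ in $G$. $Aff(1,p)=\{f_{\mu,t}\mid \mu\in\mathbb{Z}_p\setminus\{0\},\ t\in\mathbb{Z}_p\}$, where $f_{\mu,t}:\mathbb{Z}_p\to\mathbb{Z}_p$, $f_{\mu,t}(z)=\mu z+t$, regarded as a permutation group on $\mathbb{Z}_p$. For a permutation group $\mathcal{G}$ on a finite set $X$ with $|X|=m$, and $\sigma\in\mathcal{G}$, let $b_k(\sigma)$ be the number of $k$-cycles in the disjoint cycle decomposition of $\sigma$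 (fixed points counted as $1$-cycles). The cycle index (called "cyclic index" in the paper) of $\mathcal{G}$ is $$P_{\mathcal{G}}(x_1,\ldots,x_m)=\frac{1}{|\mathcal{G}|}\sum_{\sigma\in\mathcal{G}}x_1^{b_1(\sigma)}\cdots x_m^{b_m(\sigma)}\in\mathbb{Q}[x_1,\ldots,x_m].$$ *)

theory Defs
  imports
    Complex_Main
    "HOL-Algebra.Coset"
    "HOL-Combinatorics.Orbits"
    "HOL-Computational_Algebra.Primes"
    "HOL-Library.Poly_Mapping"
begin

section \<open>Normalized right transversals and isotopy\<close>

definition nrt :: "('a, 'b) monoid_scheme \<Rightarrow> 'a set \<Rightarrow> 'a set \<Rightarrow> bool" where
  "nrt G H S \<longleftrightarrow>
     S \<subseteq> carrier G \<and> \<one>\<^bsub>G\<^esub> \<in> S \<and> (\<forall>C \<in> rcosets\<^bsub>G\<^esub> H. \<exists>!x. x \<in> C \<inter> S)"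

definition induced_op :: "('a, 'b) monoid_scheme \<Rightarrow> 'a set \<Rightarrow> 'a set \<Rightarrow> 'a \<Rightarrow> 'a \<Rightarrow> 'a" where
  "induced_op G H S x y = the_elem ((H #>\<^bsub>G\<^esub> (x \<otimes>\<^bsub>G\<^esub> y)) \<inter> S)"

definition isotopic :: "'a set \<Rightarrow> ('a \<Rightarrow> 'a \<Rightarrow> 'a) \<Rightarrow> 'b set \<Rightarrow> ('b \<Rightarrow> 'b \<Rightarrow> 'b) \<Rightarrow> bool" where
  "isotopic S f S' f' \<longleftrightarrow>
     (\<exists>\<alpha> \<beta> \<gamma>. bij_betw \<alpha> S S' \<and> bij_betw \<beta> S S' \<and> bij_betw \<gamma> S S' \<and>
        (\<forall>x\<in>S. \<forall>y\<in>S. f' (\<alpha> x) (\<beta> y) = \<gamma> (f x y)))"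

definition nrt_isotopy :: "('a, 'b) monoid_scheme \<Rightarrow> 'a set \<Rightarrow> ('a set \<times> 'a set) set" where
  "nrt_isotopy G H =
     {(S, S'). nrt G H S \<and> nrt G H S' \<and>
        isotopic S (induced_op G H S) S' (induced_op G H S')}"

definition Itp :: "('a, 'b) monoid_scheme \<Rightarrow> 'a set \<Rightarrow> 'a set set set" where
  "Itp G H = {S. nrt G H S} // nrt_isotopy G H"

lemma nrt_coset_inter_op:
  assumes "group G" "subgroup H G" "nrt G H S" "x \<in> S" "y \<in> S"
  shows "(H #>\<^bsub>G\<^esub> (x \<otimes>\<^bsub>G\<^esub> y)) \<inter> S = {induced_op G H S x y}"
proof -
  interpret group G by fact
  have xy: "x \<otimes>\<^bsub>G\<^esub> y \<in> carrier G"
    using assms(3-5) by (auto simp: nrt_def)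
  have "H #>\<^bsub>G\<^esub> (x \<otimes>\<^bsub>G\<^esub> y) \<in> rcosets\<^bsub>G\<^esub> H"
    using xy by (auto simp: RCOSETS_def)
  then have "\<exists>!z. z \<in> (H #>\<^bsub>G\<^esub> (x \<otimes>\<^bsub>G\<^esub> y)) \<inter> S"
    using assms(3) unfolding nrt_def by blast
  then obtain z where "(H #>\<^bsub>G\<^esub> (x \<otimes>\<^bsub>G\<^esub> y)) \<inter> S = {z}"
    by blast
  then show ?thesis
    by (simp add: induced_op_def)
qed

lemma equiv_nrt_isotopy:
  assumes "group G" "subgroup H G"
  shows "equiv {S. nrt G H S} (nrt_isotopy G H)"
proof (rule equivI)
  show "nrt_isotopy G H \<subseteq> {S. nrt G H S} \<times> {S. nrt G H S}"
    by (auto simp: nrt_isotopy_def)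
  show "refl_on {S. nrt G H S} (nrt_isotopy G H)"
    unfolding refl_on_def nrt_isotopy_def isotopic_def
    by (auto intro!: exI[of _ id])
  show "sym (nrt_isotopy G H)"
  proof (rule symI)
    fix S S' assume "(S, S') \<in> nrt_isotopy G H"
    then obtain \<alpha> \<beta> \<gamma> where n: "nrt G H S" "nrt G H S'"
      and b: "bij_betw \<alpha> S S'" "bij_betw \<beta> S S'" "bij_betw \<gamma> S S'"
      and e: "\<And>x y. x \<in> S \<Longrightarrow> y \<in> S \<Longrightarrow>
            induced_op G H S' (\<alpha> x) (\<beta> y) = \<gamma> (induced_op G H S x y)"
      unfolding nrt_isotopy_def isotopic_def by auto
    have "induced_op G H S (inv_into S \<alpha> x) (inv_into S \<beta> y)
        = inv_into S \<gamma> (induced_op G H S' x y)" if "x \<in> S'" "y \<in> S'" for x y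
    proof -
      let ?u = "inv_into S \<alpha> x" and ?v = "inv_into S \<beta> y"
      have uv: "?u \<in> S" "?v \<in> S" "\<alpha> ?u = x" "\<beta> ?v = y"
        using b that
        by (auto simp: bij_betw_inv_into_right bij_betw_def inv_into_into f_inv_into_f)
      have "induced_op G H S ?u ?v \<in> S"
        using nrt_coset_inter_op[OF assms n(1) uv(1,2)] by auto
      then show ?thesis
        using e[OF uv(1,2)] uv b(3) by (simp add: bij_betw_inv_into_left)
    qed
    then show "(S', S) \<in> nrt_isotopy G H"
      using n b[THEN bij_betw_inv_into] unfolding nrt_isotopy_def isotopic_def by blast
  qed
  show "trans (nrt_isotopy G H)"
  proof (rule transI)
    fix S S' S'' assume "(S, S') \<in> nrt_isotopy G H" "(S', S'') \<in> nrt_isotopy G H"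
    then obtain \<alpha> \<beta> \<gamma> \<alpha>' \<beta>' \<gamma>' where n: "nrt G H S" "nrt G H S''"
      and b: "bij_betw \<alpha> S S'" "bij_betw \<beta> S S'" "bij_betw \<gamma> S S'"
      and b': "bij_betw \<alpha>' S' S''" "bij_betw \<beta>' S' S''" "bij_betw \<gamma>' S' S''"
      and e: "\<And>x y. x \<in> S \<Longrightarrow> y \<in> S \<Longrightarrow>
            induced_op G H S' (\<alpha> x) (\<beta> y) = \<gamma> (induced_op G H S x y)"
      and e': "\<And>x y. x \<in> S' \<Longrightarrow> y \<in> S' \<Longrightarrow>
            induced_op G H S'' (\<alpha>' x) (\<beta>' y) = \<gamma>' (induced_op G H S' x y)"
      unfolding nrt_isotopy_def isotopic_def by auto
    have "induced_op G H S'' ((\<alpha>' \<circ> \<alpha>) x) ((\<beta>' \<circ> \<beta>) y)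
        = (\<gamma>' \<circ> \<gamma>) (induced_op G H S x y)" if "x \<in> S" "y \<in> S" for x y
      using e e' b that by (simp add: bij_betw_apply)
    then show "(S, S'') \<in> nrt_isotopy G H"
      using n bij_betw_trans[OF b(1) b'(1)] bij_betw_trans[OF b(2) b'(2)]
        bij_betw_trans[OF b(3) b'(3)]
      unfolding nrt_isotopy_def isotopic_def by blast
  qed
qed


section \<open>The dihedral group\<close>

text \<open>The dihedral group of order \<open>2 n\<close> as a semidirect product: the pair \<open>(a, s)\<close> stands for
  the element \<open>x\<^sup>a\<close> if \<open>s\<close> is false and \<open>x\<^sup>a y\<close> if \<open>s\<close> is true, where \<open>x\<close> is the rotation of
  order \<open>n\<close> and \<open>y\<close> is a reflection, so that \<open>y x y = x\<^sup>-\<^sup>1\<close>.\<close>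

definition dihedral_group :: "nat \<Rightarrow> (int \<times> bool) monoid" where
  "dihedral_group n =
     \<lparr>carrier = {0..<int n} \<times> UNIV,
      monoid.mult = (\<lambda>(a, s) (b, t). ((if s then a - b else a + b) mod int n, s \<noteq> t)),
      one = (0, False)\<rparr>"

lemma order_dihedral_group: "order (dihedral_group n) = 2 * n"
  by (simp add: order_def dihedral_group_def card_cartesian_product)

lemma group_dihedral_group:
  assumes "n > 0"
  shows "group (dihedral_group n)"
proof (rule groupI)
  fix g assume g: "g \<in> carrier (dihedral_group n)"
  then obtain a s where as: "g = (a, s)" "0 \<le> a" "a < int n"
    by (auto simp: dihedral_group_def)
  show "\<exists>h\<in>carrier (dihedral_group n). h \<otimes>\<^bsub>dihedral_group n\<^esub> g = \<one>\<^bsub>dihedral_group n\<^esub>"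
    using as assms
    by (intro bexI[of _ "(if s then a else (- a) mod int n, s)"])
       (auto simp: dihedral_group_def mod_simps)
qed (use assms in \<open>auto simp: dihedral_group_def mod_simps algebra_simps\<close>)


section \<open>Polynomials in the indeterminates $x_1, x_2, \ldots$ and the cycle index\<close>

text \<open>A monomial is a finitely supported map from indices of indeterminates to exponents, and a
  polynomial is a finitely supported map from monomials to coefficients.\<close>

type_synonym 'a mpolynomial = "(nat \<Rightarrow>\<^sub>0 nat) \<Rightarrow>\<^sub>0 'a"

definition eval_mpolynomial :: "(nat \<Rightarrow> 'a) \<Rightarrow> 'a::comm_semiring_1 mpolynomial \<Rightarrow> 'a" where
  "eval_mpolynomial v P =
     (\<Sum>m\<in>Poly_Mapping.keys P.
        Poly_Mapping.lookup P m * (\<Prod>k\<in>Poly_Mapping.keys m. v k ^ Poly_Mapping.lookup m k))"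

text \<open>The cycles of a permutation are counted through their underlying sets; fixed points give
  the singletons.\<close>

definition cycle_count :: "'a set \<Rightarrow> ('a \<Rightarrow> 'a) \<Rightarrow> nat \<Rightarrow> nat" where
  "cycle_count X \<sigma> k = card {C. C \<subseteq> X \<and> cyclic_on \<sigma> C \<and> card C = k}"

definition cycle_index :: "'a set \<Rightarrow> ('a \<Rightarrow> 'a) set \<Rightarrow> rat mpolynomial" where
  "cycle_index X \<G> =
     (\<Sum>\<sigma>\<in>\<G>. Poly_Mapping.single
        (\<Sum>k=1..card X. Poly_Mapping.single k (cycle_count X \<sigma> k)) (1 / of_nat (card \<G>)))"

lemma eval_mpolynomial_superset:
  assumes "finite K" "Poly_Mapping.keys P \<subseteq> K"
  shows "eval_mpolynomial v P =
     (\<Sum>m\<in>K. Poly_Mapping.lookup P m *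
        (\<Prod>k\<in>Poly_Mapping.keys m. v k ^ Poly_Mapping.lookup m k))"
  unfolding eval_mpolynomial_def using assms
  by (intro sum.mono_neutral_left) (auto simp: in_keys_iff)

lemma eval_mpolynomial_add:
  "eval_mpolynomial v (P + Q) = eval_mpolynomial v P + eval_mpolynomial v Q"
proof -
  let ?K = "Poly_Mapping.keys P \<union> Poly_Mapping.keys Q"
  have "Poly_Mapping.keys (P + Q) \<subseteq> ?K"
    by (rule Poly_Mapping.keys_add)
  then show ?thesis
    by (simp add: eval_mpolynomial_superset[of ?K] lookup_add distrib_right sum.distrib)
qed

lemma eval_mpolynomial_sum:
  "eval_mpolynomial v (\<Sum>i\<in>I. P i) = (\<Sum>i\<in>I. eval_mpolynomial v (P i))"
  by (induction I rule: infinite_finite_induct)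
     (simp_all add: eval_mpolynomial_add, simp_all add: eval_mpolynomial_def)

lemma eval_mpolynomial_single:
  "eval_mpolynomial v (Poly_Mapping.single m c) =
     c * (\<Prod>k\<in>Poly_Mapping.keys m. v k ^ Poly_Mapping.lookup m k)"
  by (simp add: eval_mpolynomial_superset[of "{m}"])

lemma eval_cycle_index:
  "eval_mpolynomial v (cycle_index X \<G>) =
     1 / of_nat (card \<G>) * (\<Sum>\<sigma>\<in>\<G>. \<Prod>k=1..card X. v k ^ cycle_count X \<sigma> k)"
proof -
  have "(\<Prod>k\<in>Poly_Mapping.keys m. v k ^ Poly_Mapping.lookup m k)
      = (\<Prod>k=1..card X. v k ^ cycle_count X \<sigma> k)"
    if m: "m = (\<Sum>k=1..card X. Poly_Mapping.single k (cycle_count X \<sigma> k))" for m \<sigma>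
  proof -
    have l: "Poly_Mapping.lookup m k = (if k \<in> {1..card X} then cycle_count X \<sigma> k else 0)" for k
      unfolding m by (simp add: lookup_sum lookup_single when_def)
    have "(\<Prod>k\<in>Poly_Mapping.keys m. v k ^ Poly_Mapping.lookup m k)
        = (\<Prod>k=1..card X. v k ^ Poly_Mapping.lookup m k)"
      using l by (intro prod.mono_neutral_left) (auto simp: in_keys_iff split: if_splits)
    then show ?thesis
      by (simp add: l)
  qed
  then show ?thesis
    by (simp add: cycle_index_def eval_mpolynomial_sum eval_mpolynomial_single
        flip: sum_distrib_left sum_divide_distrib)
qed


section \<open>The one-dimensional affine group over the residues modulo $p$\<close>

text \<open>The residues modulo \<open>p\<close> are \<open>{0..<int p}\<close>. As usual for permutations of a proper subset of
  a type, the maps are extended by the identity.\<close>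

definition affine_map :: "nat \<Rightarrow> int \<Rightarrow> int \<Rightarrow> int \<Rightarrow> int" where
  "affine_map p \<mu> t = restrict_id (\<lambda>z. (\<mu> * z + t) mod int p) {0..<int p}"

definition Aff :: "nat \<Rightarrow> (int \<Rightarrow> int) set" where
  "Aff p = {affine_map p \<mu> t | \<mu> t. \<mu> \<in> {0..<int p} - {0} \<and> t \<in> {0..<int p}}"

lemma Aff_permutes:
  assumes "prime p" "\<sigma> \<in> Aff p"
  shows "\<sigma> permutes {0..<int p}"
proof -
  from assms(2) obtain \<mu> t where \<mu>: "0 < \<mu>" "\<mu> < int p" and \<sigma>: "\<sigma> = affine_map p \<mu> t"
    unfolding Aff_def by force
  have p: "0 < int p"
    using assms(1) by (simp add: prime_gt_0_nat)
  have "inj_on (\<lambda>z. (\<mu> * z + t) mod int p) {0..<int p}"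
  proof (rule inj_onI)
    fix y z assume yz: "y \<in> {0..<int p}" "z \<in> {0..<int p}"
      and "(\<mu> * y + t) mod int p = (\<mu> * z + t) mod int p"
    then have "int p dvd (\<mu> * y + t) - (\<mu> * z + t)"
      by (simp only: mod_eq_dvd_iff)
    then have "int p dvd \<mu> * (y - z)"
      by (simp add: algebra_simps)
    moreover have "\<not> int p dvd \<mu>"
      using \<mu> zdvd_not_zless by blast
    ultimately have "int p dvd y - z"
      using assms(1) by (simp add: prime_dvd_mult_iff)
    then show "y = z"
      using yz by (metis atLeastLessThan_iff mod_eq_dvd_iff mod_pos_pos_trivial)
  qed
  moreover have "(\<lambda>z. (\<mu> * z + t) mod int p) ` {0..<int p} \<subseteq> {0..<int p}"
    using p by auto
  ultimately have "bij_betw (\<lambda>z. (\<mu> * z + t) mod int p) {0..<int p} {0..<int p}"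
    by (simp add: bij_betw_def endo_inj_surj)
  then show ?thesis
    unfolding \<sigma> affine_map_def by (rule permutes_restrict_id)
qed

end

theory Submission
  imports
    Defs
    "HOL-Algebra.Group_Action"
    "HOL-Number_Theory.Cong"
begin

text \<open>The right coset of the rotation $x^i$ is $\{x^i, y x^i\}$, where $H = \{1, y\}$, so a normalized
  right transversal amounts to the set \<open>A\<close> of those nonzero residues \<open>i\<close> at which $y x^i$ is chosen,
  and its right translations are $i \mapsto \pm i + j$, with the minus sign exactly for \<open>j\<close> in \<open>A\<close>.
  Quotients of two right translations are translations if the signs agree and reflections, which
  have a fixed point, if they differ. An isotopy conjugates these quotients, so it respects
  equality of signs; it conjugates some nontrivial translation to a translation, which makes it
  affine. Hence \<open>A\<close> and \<open>B\<close> give isotopic transversals iff an affine map takes \<open>A\<close> to \<open>B\<close> or to its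
  complement. Burnside's lemma for the affine group times the complementation counts these
  classes: pairs with a nontrivial complementation fix no subset, because \<open>p\<close> is odd.\<close>

section \<open>Subsets up to a permutation group and complementation\<close>

text \<open>The direct product of \<open>K\<close> with the group of order two; inequality of the
  flags is addition modulo 2. A true flag stands for complementation.\<close>

definition compl_group :: "('a \<Rightarrow> 'a) set \<Rightarrow> (('a \<Rightarrow> 'a) \<times> bool) monoid" where
  "compl_group K =
     \<lparr>carrier = K \<times> UNIV,
      monoid.mult = (\<lambda>(f, s) (g, t). (f \<circ> g, s \<noteq> t)),
      one = (id, False)\<rparr>"

text \<open>The abstraction is restricted to \<open>Pow Z\<close> because elements of
  \<open>BijGroup\<close> must be extensional, that is, undefined off the carrier.\<close>

definition compl_act :: "'a set \<Rightarrow> ('a \<Rightarrow> 'a) \<times> bool \<Rightarrow> 'a set \<Rightarrow> 'a set" where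
  "compl_act Z = (\<lambda>(f, s). \<lambda>A\<in>Pow Z. if s then Z - f ` A else f ` A)"

lemma image_Diff_permutes: "f permutes Z \<Longrightarrow> A \<subseteq> Z \<Longrightarrow> f ` (Z - A) = Z - f ` A"
  by (metis image_set_diff permutes_image permutes_inj)

lemma group_compl_group:
  assumes "id \<in> K"
    and "\<And>f g. f \<in> K \<Longrightarrow> g \<in> K \<Longrightarrow> f \<circ> g \<in> K" "\<And>f. f \<in> K \<Longrightarrow> \<exists>g\<in>K. g \<circ> f = id"
  shows "group (compl_group K)"
proof (rule groupI)
  fix x assume "x \<in> carrier (compl_group K)"
  then obtain f s where x: "x = (f, s)" "f \<in> K"
    by (auto simp: compl_group_def)
  then obtain g where "g \<in> K" "g \<circ> f = id"
    using assms(3) by blast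
  then show "\<exists>y\<in>carrier (compl_group K).
      y \<otimes>\<^bsub>compl_group K\<^esub> x = \<one>\<^bsub>compl_group K\<^esub>"
    using x by (intro bexI[of _ "(g, s)"]) (auto simp: compl_group_def)
qed (use assms in \<open>auto simp: compl_group_def o_assoc\<close>)

text \<open>The action law holds because a permutation of \<open>Z\<close> commutes with taking
  complements in \<open>Z\<close>, and complementing twice is the identity.\<close>

lemma group_action_compl:
  assumes K: "\<And>f. f \<in> K \<Longrightarrow> f permutes Z" and "id \<in> K"
    and "\<And>f g. f \<in> K \<Longrightarrow> g \<in> K \<Longrightarrow> f \<circ> g \<in> K" "\<And>f. f \<in> K \<Longrightarrow> \<exists>g\<in>K. g \<circ> f = id"
  shows "group_action (compl_group K) (Pow Z) (compl_act Z)"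
proof -
  have bij: "compl_act Z x \<in> Bij (Pow Z)" if x: "x \<in> carrier (compl_group K)" for x
  proof -
    obtain f s where fs: "x = (f, s)" "f permutes Z"
      using x K by (auto simp: compl_group_def)
    have im: "bij_betw ((`) f) (Pow Z) (Pow Z)"
      using fs(2) by (simp add: bij_betw_Pow permutes_imp_bij)
    have co: "bij_betw (\<lambda>A. Z - A) (Pow Z) (Pow Z)"
      by (rule bij_betwI[where g = "\<lambda>A. Z - A"]) auto
    have "bij_betw (\<lambda>A. if s then Z - f ` A else f ` A) (Pow Z) (Pow Z)"
      using im bij_betw_trans[OF im co] by (cases s) (simp_all add: o_def)
    also have "?this \<longleftrightarrow> bij_betw (compl_act Z x) (Pow Z) (Pow Z)"
      by (rule bij_betw_cong) (simp add: compl_act_def fs)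
    finally show ?thesis
      by (simp add: Bij_def compl_act_def fs)
  qed
  have comp: "compl_act Z (x \<otimes>\<^bsub>compl_group K\<^esub> y) =
      compose (Pow Z) (compl_act Z x) (compl_act Z y)"
    if xy: "x \<in> carrier (compl_group K)" "y \<in> carrier (compl_group K)" for x y
  proof -
    obtain f s g t where fs: "x = (f, s)" "y = (g, t)" "f permutes Z" "g permutes Z"
      using xy K by (auto simp: compl_group_def)
    show ?thesis
    proof
      fix A
      show "compl_act Z (x \<otimes>\<^bsub>compl_group K\<^esub> y) A =
          compose (Pow Z) (compl_act Z x) (compl_act Z y) A"
      proof (cases "A \<subseteq> Z")
        case True
        then have gA: "g ` A \<subseteq> Z"
          using permutes_image[OF fs(4)] by blast
        then have "f ` g ` A \<subseteq> Z"
          using permutes_image[OF fs(3)] by blast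
        then show ?thesis
          using True gA
          by (simp add: compl_act_def compl_group_def fs compose_def image_image
              image_Diff_permutes[OF fs(3)] double_diff)
      qed (simp add: compl_act_def compl_group_def fs compose_def)
    qed
  qed
  interpret group "compl_group K"
    by (rule group_compl_group) (use assms in auto)
  have "compl_act Z \<in> hom (compl_group K) (BijGroup (Pow Z))"
    using bij comp by (auto simp: hom_def BijGroup_def)
  then show ?thesis
    by (simp add: group_action_def group_hom_def group_hom_axioms_def group_BijGroup is_group)
qed

section \<open>Invariant subsets, cycles and the Burnside count\<close>

text \<open>A set is stable under \<open>f\<close> exactly when it is a union of cycles, and
  distinct cycles are disjoint, so stable sets correspond to sets of cycles. The inverse map
  collects the cycles contained in the set.\<close>

lemma bij_betw_Union_cycles:
  assumes "finite Z" and f: "f permutes Z"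
  shows "bij_betw Union (Pow {C. C \<subseteq> Z \<and> cyclic_on f C}) {A. A \<subseteq> Z \<and> f ` A = A}"
proof (rule bij_betwI[where g = "\<lambda>A. {C. C \<subseteq> A \<and> cyclic_on f C}"])
  have perm: "permutation f"
    using assms by (auto simp: permutation_permutes)
  have self: "x \<in> Orbits.orbit f x" for x
    by (rule permutation_self_in_orbit[OF perm])
  have orb: "C = Orbits.orbit f x" if "cyclic_on f C" "x \<in> C" for C x
    using that by (simp add: cyclic_on_alldef)
  have cyc_im: "f ` C = C" if "cyclic_on f C" "C \<subseteq> Z" for C
  proof (rule endo_inj_surj)
    show "finite C" "inj_on f C"
      using that assms permutes_inj_on finite_subset by blast+
    show "f ` C \<subseteq> C"
      using that orb orbit.base by fastforce
  qed
  show "Union \<in> Pow {C. C \<subseteq> Z \<and> cyclic_on f C} \<rightarrow> {A. A \<subseteq> Z \<and> f ` A = A}"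
    using cyc_im by (auto simp: image_Union) blast+
  show "(\<lambda>A. {C. C \<subseteq> A \<and> cyclic_on f C}) \<in>
      {A. A \<subseteq> Z \<and> f ` A = A} \<rightarrow> Pow {C. C \<subseteq> Z \<and> cyclic_on f C}"
    by blast
  show "{C. C \<subseteq> \<Union>\<C> \<and> cyclic_on f C} = \<C>"
    if \<C>: "\<C> \<in> Pow {C. C \<subseteq> Z \<and> cyclic_on f C}" for \<C>
  proof (intro equalityI subsetI)
    fix C assume C: "C \<in> {C. C \<subseteq> \<Union>\<C> \<and> cyclic_on f C}"
    then obtain x where x: "x \<in> C"
      by (auto simp: cyclic_on_def)
    then obtain D where D: "D \<in> \<C>" "x \<in> D"
      using C by blast
    \<comment> \<open>Two cycles with a common point \<open>x\<close> coincide, since each of them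
      is the orbit of \<open>x\<close>.\<close>
    then have "D = C"
      using orb[of D x] orb[of C x] C x \<C> by blast
    with D show "C \<in> \<C>" by simp
  qed (use \<C> in auto)
  show "\<Union>{C. C \<subseteq> A \<and> cyclic_on f C} = A" if A: "A \<in> {A. A \<subseteq> Z \<and> f ` A = A}" for A
  proof (intro equalityI subsetI)
    fix x assume x: "x \<in> A"
    have "y \<in> A" if "y \<in> Orbits.orbit f x" for y
      using that by induction (use A x in auto)
    moreover have "cyclic_on f (Orbits.orbit f x)"
      using self by (auto simp: cyclic_on_def)
    ultimately show "x \<in> \<Union>{C. C \<subseteq> A \<and> cyclic_on f C}"
      using self[of x] by blast
  qed auto
qed

text \<open>Giving all indeterminates the same value forgets the lengths of the cycles; only their
  total number survives as an exponent.\<close>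

lemma prod_power_cycle_count:
  fixes c :: "'b::comm_semiring_1"
  assumes "finite Z"
  shows "(\<Prod>k=1..card Z. c ^ cycle_count Z f k) = c ^ card {C. C \<subseteq> Z \<and> cyclic_on f C}"
proof -
  let ?C = "{C. C \<subseteq> Z \<and> cyclic_on f C}"
  have "finite ?C" using assms by simp
  moreover have "card ` ?C \<subseteq> {1..card Z}"
    using assms by (auto simp: cyclic_on_def card_mono Suc_le_eq card_gt_0_iff finite_subset)
  ultimately have "(\<Sum>k=1..card Z. \<Sum>C\<in>{C\<in>?C. card C = k}. 1) = (\<Sum>C\<in>?C. 1::nat)"
    by (intro sum.group) auto
  then have "(\<Sum>k=1..card Z. cycle_count Z f k) = card ?C"
    by (simp add: cycle_count_def conj_assoc)
  then show ?thesis
    by (simp flip: power_sum)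
qed

text \<open>In Burnside's lemma the elements \<open>(f, False)\<close> contribute the terms of the
  cycle index at 2 and the elements \<open>(f, True)\<close> contribute nothing, while the group
  order is \<open>2 * card K\<close>. This is the source of the final division by 2.\<close>

lemma card_orbits_compl:
  assumes Z: "finite Z" "odd (card Z)"
    and K: "\<And>f. f \<in> K \<Longrightarrow> f permutes Z" "id \<in> K"
      "\<And>f g. f \<in> K \<Longrightarrow> g \<in> K \<Longrightarrow> f \<circ> g \<in> K" "\<And>f. f \<in> K \<Longrightarrow> \<exists>g\<in>K. g \<circ> f = id"
  shows "of_nat (card (orbits (compl_group K) (Pow Z) (compl_act Z))) =
     eval_mpolynomial (\<lambda>_. 2) (cycle_index Z K) / 2"
proof -
  interpret group_action "compl_group K" "Pow Z" "compl_act Z"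
    using K by (rule group_action_compl)
  let ?O = "orbits (compl_group K) (Pow Z) (compl_act Z)"
  have finK: "finite K"
    using K(1) finite_permutations[OF Z(1)] finite_subset[of K "{f. f permutes Z}"] by blast
  have inv_False: "card (invariants (Pow Z) (compl_act Z) (f, False)) =
      2 ^ card {C. C \<subseteq> Z \<and> cyclic_on f C}" if f: "f \<in> K" for f
  proof -
    have "invariants (Pow Z) (compl_act Z) (f, False) = {A. A \<subseteq> Z \<and> f ` A = A}"
      by (auto simp: invariants_def compl_act_def)
    also have "card \<dots> = card (Pow {C. C \<subseteq> Z \<and> cyclic_on f C})"
      using bij_betw_same_card[OF bij_betw_Union_cycles[OF Z(1) K(1)[OF f]]] by simp
    finally show ?thesis
      using Z(1) by (simp add: card_Pow)
  qed
  have inv_True: "invariants (Pow Z) (compl_act Z) (f, True) = {}" if f: "f \<in> K" for f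
  proof -
    have False if A: "A \<subseteq> Z" "Z - f ` A = A" for A
    proof -
      have "card (f ` A) = card A"
        using K(1)[OF f] by (simp add: card_image permutes_inj_on)
      moreover have "f ` A \<subseteq> Z"
        using A(1) permutes_image[OF K(1)[OF f]] by blast
      then have "card A = card Z - card (f ` A)" "card (f ` A) \<le> card Z"
        using A(2) Z(1) by (metis card_Diff_subset finite_subset, meson card_mono Z(1))
      \<comment> \<open>A set mapped by \<open>f\<close> onto its own complement has half the
        elements of \<open>Z\<close>, which parity forbids.\<close>
      ultimately have "card Z = 2 * card A" by linarith
      with Z(2) show False by simp
    qed
    then show ?thesis
      by (auto simp: invariants_def compl_act_def)
  qed
  have "card ?O * (2 * card K) = card ?O * order (compl_group K)"
    by (simp add: order_def compl_group_def card_cartesian_product)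
  also have "\<dots> = (\<Sum>x\<in>carrier (compl_group K). card (invariants (Pow Z) (compl_act Z) x))"
    using finK Z(1) by (intro burnside) (simp_all add: compl_group_def)
  also have "\<dots> = (\<Sum>f\<in>K. \<Sum>s\<in>UNIV. card (invariants (Pow Z) (compl_act Z) (f, s)))"
    by (simp add: compl_group_def sum.cartesian_product)
  also have "\<dots> = (\<Sum>f\<in>K. 2 ^ card {C. C \<subseteq> Z \<and> cyclic_on f C})"
    by (rule sum.cong) (simp_all add: UNIV_bool inv_False inv_True)
  finally have "of_nat (card ?O * (2 * card K)) =
      (of_nat (\<Sum>f\<in>K. 2 ^ card {C. C \<subseteq> Z \<and> cyclic_on f C}) :: rat)"
    by (rule arg_cong)
  moreover have "card K \<noteq> 0"
    using finK K(2) by auto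
  ultimately show ?thesis
    unfolding eval_cycle_index prod_power_cycle_count[OF Z(1)] by (simp add: field_simps)
qed

section \<open>The affine group\<close>

text \<open>\<open>Aff\<close> asks for reduced coefficients; this permits arbitrary integers, such
  as the products and negatives produced by composition and inversion.\<close>

lemma affine_map_mod: "affine_map p (\<mu> mod int p) (t mod int p) = affine_map p \<mu> t"
proof -
  have "((\<mu> mod int p) * z + t mod int p) mod int p = (\<mu> * z + t) mod int p" for z
    unfolding cong_def[symmetric] by (intro cong_add cong_mult cong_refl) simp_all
  then show ?thesis
    by (simp add: affine_map_def)
qed

lemma affine_map_in_Aff:
  assumes "p > 0" "\<not> int p dvd \<mu>"
  shows "affine_map p \<mu> t \<in> Aff p"
proof -
  have "\<mu> mod int p \<in> {0..<int p} - {0}" "t mod int p \<in> {0..<int p}"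
    using assms by (auto simp: dvd_eq_mod_eq_0)
  then show ?thesis
    unfolding Aff_def by (subst affine_map_mod[symmetric]) blast
qed

lemma Aff_cases:
  assumes "f \<in> Aff p"
  obtains \<mu> t where "\<not> int p dvd \<mu>" "f = affine_map p \<mu> t"
proof -
  obtain \<mu> t where "\<mu> \<in> {0..<int p} - {0}" and f: "f = affine_map p \<mu> t"
    using assms unfolding Aff_def by blast
  then have "\<not> int p dvd \<mu>"
    by (intro zdvd_not_zless) auto
  then show thesis
    using f by (rule that)
qed

lemma affine_map_apply: "z \<in> {0..<int p} \<Longrightarrow> affine_map p \<mu> t z = (\<mu> * z + t) mod int p"
  by (simp add: affine_map_def)

lemma affine_map_apply_mod:
  assumes "p > 0"
  shows "affine_map p \<mu> t (x mod int p) = (\<mu> * x + t) mod int p"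
proof -
  have "[\<mu> * (x mod int p) + t = \<mu> * x + t] (mod int p)"
    by (intro cong_add cong_mult cong_refl) simp
  then show ?thesis
    using assms by (simp add: affine_map_apply cong_def)
qed

lemma affine_map_comp:
  assumes "p > 0"
  shows "affine_map p \<mu> t \<circ> affine_map p \<nu> s = affine_map p (\<mu> * \<nu>) (\<mu> * s + t)"
proof
  fix z
  show "(affine_map p \<mu> t \<circ> affine_map p \<nu> s) z = affine_map p (\<mu> * \<nu>) (\<mu> * s + t) z"
  proof (cases "z \<in> {0..<int p}")
    case True
    then show ?thesis
      by (simp add: affine_map_apply affine_map_apply_mod assms algebra_simps del: atLeastLessThan_iff)
  qed (auto simp: affine_map_def restrict_id_def)
qed

lemma id_eq_affine_map: "[\<mu> = 1] (mod int p) \<Longrightarrow> [t = 0] (mod int p) \<Longrightarrow> affine_map p \<mu> t = id"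
  by (subst affine_map_mod[symmetric])
     (auto simp: affine_map_def restrict_id_def fun_eq_iff cong_def mod_simps)

lemma id_in_Aff: "p > 1 \<Longrightarrow> id \<in> Aff p"
  using affine_map_in_Aff[of p 1 0] id_eq_affine_map[of 1 p 0] by simp

lemma Aff_comp:
  assumes "prime p" "f \<in> Aff p" "g \<in> Aff p"
  shows "f \<circ> g \<in> Aff p"
proof -
  obtain \<mu> t \<nu> s where "\<not> int p dvd \<mu>" "f = affine_map p \<mu> t"
    "\<not> int p dvd \<nu>" "g = affine_map p \<nu> s"
    using assms by (metis Aff_cases)
  then show ?thesis
    using assms(1)
    by (simp add: affine_map_comp affine_map_in_Aff prime_dvd_mult_iff prime_gt_0_nat)
qed

lemma Aff_left_inverse:
  assumes "prime p" "f \<in> Aff p"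
  shows "\<exists>g\<in>Aff p. g \<circ> f = id"
proof -
  obtain \<mu> t where \<mu>: "\<not> int p dvd \<mu>" and f: "f = affine_map p \<mu> t"
    using assms(2) by (rule Aff_cases)
  have "coprime (int p) \<mu>"
    using assms(1) \<mu> by (intro prime_imp_coprime) auto
  then obtain \<nu> where \<nu>: "[\<mu> * \<nu> = 1] (mod int p)"
    using cong_solve_coprime_int by (metis coprime_commute)
  have "\<not> int p dvd \<nu>"
  proof
    assume "int p dvd \<nu>"
    then have "int p dvd \<mu> * \<nu>" by simp
    then have "int p dvd 1"
      using \<nu> cong_dvd_iff by blast
    with assms(1) show False by auto
  qed
  \<comment> \<open>Solving \<open>w = \<mu> * z + t\<close> for \<open>z\<close> gives
    \<open>\<nu> * w - \<nu> * t\<close>.\<close>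
  moreover have "affine_map p \<nu> (- \<nu> * t) \<circ> f = id"
    using \<nu> prime_gt_0_nat[OF assms(1)]
    by (simp add: f affine_map_comp id_eq_affine_map mult.commute)
  ultimately show ?thesis
    using prime_gt_0_nat[OF assms(1)] affine_map_in_Aff by blast
qed

section \<open>Isotopies between signed additions of residues\<close>

text \<open>The arithmetic core. Here \<open>g\<close> and \<open>a\<close> are periodic extensions
  of the isotopy components \<open>\<gamma>\<close> and \<open>\<alpha>\<close>, \<open>b\<close> is
  \<open>\<beta>\<close>, and \<open>e j\<close>, \<open>d j\<close> are the signs of the right
  translations by \<open>j\<close> and by its image. The conclusions say that \<open>b\<close> is
  affine and that the two sign patterns agree up to one global sign.\<close>

lemma affine_of_signed_isotopy:
  fixes q :: int and g a b e d :: "int \<Rightarrow> int"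
  assumes q: "prime q" "odd q"
    and eq: "\<And>i j. j \<in> {0..<q} \<Longrightarrow> [g (e j * i + j) = d j * a i + b j] (mod q)"
    and e: "\<And>j. j \<in> {0..<q} \<Longrightarrow> e j = 1 \<or> e j = -1"
    and d: "\<And>j. j \<in> {0..<q} \<Longrightarrow> d j = 1 \<or> d j = -1"
    and g_cong: "\<And>x y. [x = y] (mod q) \<Longrightarrow> [g x = g y] (mod q)"
    and g_inj: "\<And>x y. [g x = g y] (mod q) \<Longrightarrow> [x = y] (mod q)"
    and g_surj: "\<And>y. \<exists>x. [g x = y] (mod q)"
    and b_inj: "\<And>j k. j \<in> {0..<q} \<Longrightarrow> k \<in> {0..<q} \<Longrightarrow> [b j = b k] (mod q) \<Longrightarrow> j = k"
  shows "\<exists>\<mu> t. \<not> q dvd \<mu> \<and> (\<forall>j\<in>{0..<q}. [b j = \<mu> * j + t] (mod q))"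
    and "\<And>j k. j \<in> {0..<q} \<Longrightarrow> k \<in> {0..<q} \<Longrightarrow> e j * e k = d j * d k"
proof -
  have q3: "q \<ge> 3"
    using q prime_ge_2_int[of q] by (cases "q = 2") auto
  have res_eq: "j = k" if "[j = k] (mod q)" "j \<in> {0..<q}" "k \<in> {0..<q}" for j k
    using that by (simp add: cong_def)
  have cop: "coprime x q" if "\<not> q dvd x" for x
    using prime_imp_coprime[OF q(1) that] by (subst coprime_commute)
  have "coprime 2 q"
    using q(2) by simp
  then obtain h where h: "[2 * h = 1] (mod q)"
    using cong_solve_coprime_int by blast
  have half: "[2 * (h * x) = x] (mod q)" for x
    using cong_scalar_right[OF h, of x] by (simp add: mult.assoc)

  \<comment> \<open>Eliminating \<open>a\<close> between the equations for \<open>j\<close> and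
    \<open>k\<close>: conjugation by \<open>g\<close> takes the quotient of two right translations
    on one side to the corresponding quotient on the other.\<close>
  have star: "[g (e j * e k * (z - k) + j) = d j * d k * (g z - b k) + b j] (mod q)"
    if j: "j \<in> {0..<q}" and k: "k \<in> {0..<q}" for j k z
  proof -
    have ek: "e k * e k = 1" and dk: "d k * d k = 1"
      using e[OF k] d[OF k] by auto
    \<comment> \<open>The preimage of \<open>z\<close> under the right translation by
      \<open>k\<close>; a sign is its own inverse.\<close>
    define i where "i = e k * (z - k)"
    have "e k * i + k = e k * e k * (z - k) + k"
      by (simp add: i_def)
    also have "\<dots> = z"
      by (simp add: ek)
    finally have 1: "[g z = d k * a i + b k] (mod q)"
      using eq[OF k, of i] by simp
    have "[g (e j * i + j) = d j * a i + b j] (mod q)"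
      by (rule eq[OF j])
    also have "d j * a i + b j = d j * d k * ((d k * a i + b k) - b k) + b j"
      by (simp add: algebra_simps flip: dk)
    also have "[\<dots> = d j * d k * (g z - b k) + b j] (mod q)"
      using 1 by (intro cong_add cong_mult cong_diff cong_refl) (rule cong_sym)
    finally show ?thesis
      by (simp add: i_def mult.assoc)
  qed

  show sign: "e j * e k = d j * d k" if j: "j \<in> {0..<q}" and k: "k \<in> {0..<q}" for j k
  proof (cases "j = k")
    case True
    then show ?thesis using e[OF k] d[OF k] by auto
  next
    case False
    have "e j * e k = 1 \<or> e j * e k = -1" "d j * d k = 1 \<or> d j * d k = -1"
      using e[OF j] e[OF k] d[OF j] d[OF k] by auto
    \<comment> \<open>The image is a reflection, with fixed point half of \<open>b k + b j\<close>.
      Pulled back along \<open>g\<close>, it would be fixed by the translation by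
      \<open>j - k\<close>, which is nonzero.\<close>
    moreover have False if "e j * e k = 1" "d j * d k = -1"
    proof -
      obtain z where z: "[g z = h * (b k + b j)] (mod q)"
        using g_surj by blast
      have "[g (z - k + j) = b k + b j - g z] (mod q)"
        using star[OF j k, of z] that by (simp add: algebra_simps)
      also have "[b k + b j - g z = 2 * (h * (b k + b j)) - h * (b k + b j)] (mod q)"
        using half[of "b k + b j"] z by (intro cong_diff) (auto simp: cong_sym)
      also have "2 * (h * (b k + b j)) - h * (b k + b j) = h * (b k + b j)"
        by simp
      also have "[\<dots> = g z] (mod q)"
        using z by (rule cong_sym)
      finally have "[z - k + j = z] (mod q)"
        by (rule g_inj)
      then have "[j = k] (mod q)"
        by (simp add: cong_iff_dvd_diff)
      with False j k res_eq show False by blast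
    qed
    \<comment> \<open>Now the source is the reflection, fixing half of \<open>j + k\<close>; its
      image under \<open>g\<close> would be fixed by the translation by \<open>b j - b k\<close>,
      nonzero by injectivity of \<open>b\<close>.\<close>
    moreover have False if "e j * e k = -1" "d j * d k = 1"
    proof -
      define z where "z = h * (j + k)"
      have "[j + k - z = z] (mod q)"
        using cong_diff[OF cong_sym[OF half[of "j + k"]] cong_refl[of z]]
        by (simp add: z_def)
      then have "[g (j + k - z) = g z] (mod q)"
        by (rule g_cong)
      moreover have "[g (j + k - z) = g z - b k + b j] (mod q)"
        using star[OF j k, of z] that by (simp add: algebra_simps)
      ultimately have "[g z = g z - b k + b j] (mod q)"
        by (meson cong_sym cong_trans)
      then have "[b k = b j] (mod q)"
        by (simp add: cong_iff_dvd_diff)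
      with False j k b_inj show False by blast
    qed
    ultimately show ?thesis by auto
  qed

  \<comment> \<open>Pigeonhole: three residues share two signs.\<close>
  obtain j k where jk: "j \<in> {0..<q}" "k \<in> {0..<q}" "j \<noteq> k" "e j = e k"
  proof -
    have in3: "0 \<in> {0..<q}" "1 \<in> {0..<q}" "2 \<in> {0..<q}"
      using q3 by auto
    have "e 0 = e 1 \<or> e 0 = e 2 \<or> e 1 = e 2"
      using in3[THEN e] by auto
    then show thesis
      using in3 that by fastforce
  qed
  have "e j * e k = 1"
    using e[OF jk(2)] jk(4) by auto
  \<comment> \<open>With equal signs, \<open>star\<close> turns the nonzero translation by
    \<open>j - k\<close> into the translation by \<open>b j - b k\<close>.\<close>
  then have trans: "[g (z + (j - k)) = g z + (b j - b k)] (mod q)" for z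
    using star[OF jk(1,2), of z] sign[OF jk(1,2)] by (simp add: algebra_simps)
  have "\<not> q dvd j - k"
    using jk res_eq by (auto simp: cong_iff_dvd_diff)
  then have "coprime (j - k) q"
    by (rule cop)
  then obtain u0 where "[(j - k) * u0 = 1] (mod q)"
    using cong_solve_coprime_int by blast
  \<comment> \<open>The inverse of \<open>j - k\<close> is taken as a natural number, so that it can
    count iterations of \<open>trans\<close>.\<close>
  moreover define u where "u = nat (u0 mod q)"
  moreover have "int u = u0 mod q"
    using q3 by (simp add: u_def)
  ultimately have u: "[(j - k) * int u = 1] (mod q)"
    by (simp add: cong_def mod_mult_right_eq)
  have iter: "[g (z + int n * (j - k)) = g z + int n * (b j - b k)] (mod q)" for z n
  proof (induction n)
    case (Suc n)
    have "[g (z + int n * (j - k) + (j - k)) = g (z + int n * (j - k)) + (b j - b k)] (mod q)"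
      by (rule trans)
    also have "[g (z + int n * (j - k)) + (b j - b k) =
        g z + int n * (b j - b k) + (b j - b k)] (mod q)"
      using Suc by (intro cong_add cong_refl)
    finally show ?case
      by (simp add: algebra_simps)
  qed simp
  \<comment> \<open>Translating \<open>u\<close> times by \<open>j - k\<close> is translating by 1,
    so this \<open>\<mu>\<close> is the increment of \<open>g\<close> per unit step.\<close>
  define \<mu> t where "\<mu> = int u * (b j - b k)" and "t = g 0"
  have g_affine: "[g z = \<mu> * z + t] (mod q)" for z
  proof -
    define n where "n = nat (z mod q)"
    have n: "int n = z mod q"
      using q3 by (simp add: n_def)
    have "[z = int n * ((j - k) * int u)] (mod q)"
      using cong_mult[of "int n" z q, OF _ u] by (simp add: n cong_sym)
    also have "int n * ((j - k) * int u) = 0 + int (n * u) * (j - k)"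
      by simp
    finally have "[g z = g (0 + int (n * u) * (j - k))] (mod q)"
      by (rule g_cong)
    also have "[g (0 + int (n * u) * (j - k)) = g 0 + int (n * u) * (b j - b k)] (mod q)"
      by (rule iter)
    also have "g 0 + int (n * u) * (b j - b k) = \<mu> * int n + t"
      by (simp add: \<mu>_def t_def)
    also have "[\<dots> = \<mu> * z + t] (mod q)"
      by (intro cong_add cong_mult cong_refl) (simp add: n)
    finally show ?thesis .
  qed
  have \<mu>: "\<not> q dvd \<mu>"
  proof
    assume "q dvd \<mu>"
    then have "[\<mu> * 0 + t = \<mu> * 1 + t] (mod q)"
      by (simp add: cong_iff_dvd_diff)
    then have "[g 0 = g 1] (mod q)"
      using cong_trans[OF g_affine cong_trans[OF _ cong_sym[OF g_affine]]] by blast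
    then have "[0 = 1] (mod q)"
      by (rule g_inj)
    then show False
      using q3 by (simp add: cong_def)
  qed
  \<comment> \<open>Setting \<open>i = 0\<close> in \<open>eq\<close> relates \<open>b\<close> to
    the affine \<open>g\<close>, up to the error \<open>d j * c\<close>.\<close>
  define c where "c = a 0"
  have b: "[b j = \<mu> * j + t - d j * c] (mod q)" if j: "j \<in> {0..<q}" for j
  proof -
    have "[d j * c + b j = \<mu> * j + t] (mod q)"
      using cong_trans[OF cong_sym[OF eq[OF j, of 0]] g_affine[of "e j * 0 + j"]]
      by (simp add: c_def)
    then show ?thesis
      by (simp add: cong_iff_dvd_diff algebra_simps)
  qed
  text \<open>Off the affine part, \<open>b\<close> shifts the two sign classes in opposite directions; injectivity
    then makes a sign class invariant under a translation.\<close>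
  have "\<exists>t. \<forall>j\<in>{0..<q}. [b j = \<mu> * j + t] (mod q)"
  proof (cases "\<forall>j\<in>{0..<q}. d j = d 0")
    case True
    have "[b j = \<mu> * j + (t - d 0 * c)] (mod q)" if j: "j \<in> {0..<q}" for j
      using b[OF j] bspec[OF True j] by (simp add: add_diff_eq)
    then show ?thesis by blast
  next
    case False
    have "q dvd c"
    proof (rule ccontr)
      assume c: "\<not> q dvd c"
      obtain k where k: "k \<in> {0..<q}" "d k \<noteq> d 0"
        using False by blast
      have d0: "d 0 = 1 \<or> d 0 = -1"
        using d q3 by auto
      have "coprime \<mu> q"
        using \<mu> by (rule cop)
      then obtain v where v: "[\<mu> * v = 1] (mod q)"
        using cong_solve_coprime_int by blast
      \<comment> \<open>The offset at which \<open>\<mu> * w\<close> cancels the difference between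
        the errors of the two sign classes.\<close>
      define w where "w = 2 * d 0 * c * v"
      have w: "[\<mu> * w = 2 * d 0 * c] (mod q)"
        using cong_scalar_left[OF v, of "2 * d 0 * c"] by (simp add: w_def mult_ac)
      have "\<not> q dvd w"
      proof
        assume "q dvd w"
        then have "q dvd \<mu> * w" by simp
        then have "q dvd 2 * d 0 * c"
          using w by (simp add: cong_dvd_iff)
        then have "q dvd 2 * c"
          using d0 by auto
        then have "q dvd 2"
          using q(1) c by (simp add: prime_dvd_mult_iff)
        then have "q \<le> 2"
          by (rule zdvd_imp_le) simp
        with q3 show False by simp
      qed
      then have "coprime w q"
        by (rule cop)
      then obtain x where x: "[w * x = 1] (mod q)"
        using cong_solve_coprime_int by blast
      \<comment> \<open>If the sign changed between \<open>j\<close> and \<open>j - w\<close>, then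
        \<open>b\<close> would take the same value at both, against injectivity.\<close>
      have shift: "d ((j - w) mod q) = d 0" if j: "j \<in> {0..<q}" "d j = d 0" for j
      proof (rule ccontr)
        let ?j = "(j - w) mod q"
        assume neq: "d ?j \<noteq> d 0"
        have j': "?j \<in> {0..<q}"
          using q3 by auto
        have dj': "d ?j = - d 0"
          using d[OF j'] d0 neq by auto
        have "[b ?j = \<mu> * ?j + t - d ?j * c] (mod q)"
          by (rule b[OF j'])
        also have "[\<mu> * ?j + t - d ?j * c = \<mu> * (j - w) + t - d ?j * c] (mod q)"
          by (intro cong_add cong_diff cong_mult cong_refl) simp
        also have "\<mu> * (j - w) + t - d ?j * c = \<mu> * j + t + d 0 * c - \<mu> * w"
          by (simp add: dj' algebra_simps)
        also have "[\<dots> = \<mu> * j + t + d 0 * c - 2 * d 0 * c] (mod q)"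
          using w by (intro cong_diff cong_refl)
        also have "\<mu> * j + t + d 0 * c - 2 * d 0 * c = \<mu> * j + t - d j * c"
          by (simp add: j)
        also have "[\<dots> = b j] (mod q)"
          using b[OF j(1)] by (rule cong_sym)
        finally have "?j = j"
          using b_inj j j' by blast
        with neq j show False by simp
      qed
      have multiples: "d ((0 - int n * w) mod q) = d 0" for n
      proof (induction n)
        case (Suc n)
        then have "d (((0 - int n * w) mod q - w) mod q) = d 0"
          using q3 by (intro shift) auto
        moreover have "0 - int n * w - w = 0 - int (Suc n) * w"
          by (simp add: algebra_simps)
        then have "((0 - int n * w) mod q - w) mod q = (0 - int (Suc n) * w) mod q"
          by (simp only: mod_diff_left_eq)
        ultimately show ?case by (simp only:)
      qed simp
      \<comment> \<open>Since \<open>x\<close> inverts \<open>w\<close>, going \<open>n\<close>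
        steps of \<open>-w\<close> from 0 reaches \<open>k\<close>, whose sign differs from that of
        0.\<close>
      define n where "n = nat ((- (x * k)) mod q)"
      have n: "int n = (- (x * k)) mod q"
        using q3 by (simp add: n_def)
      have "[0 - int n * w = 0 - (- (x * k)) * w] (mod q)"
        by (intro cong_diff cong_mult cong_refl) (simp add: n)
      also have "0 - (- (x * k)) * w = w * x * k"
        by simp
      also have "[w * x * k = 1 * k] (mod q)"
        using x by (intro cong_mult cong_refl)
      finally have "(0 - int n * w) mod q = k"
        using k by (simp add: cong_def)
      then show False
        using multiples[of n] k(2) by simp
    qed
    then have "[\<mu> * j + t - d j * c = \<mu> * j + t] (mod q)" for j
      by (simp add: cong_iff_dvd_diff)
    then show ?thesis
      using b cong_trans by blast
  qed
  with \<mu> show "\<exists>\<mu> t. \<not> q dvd \<mu> \<and> (\<forall>j\<in>{0..<q}. [b j = \<mu> * j + t] (mod q))"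
    by blast
qed


text \<open>The induced operation of a transversal, read on residues. The set may contain 0 here, so
  that complements stay within the same family.\<close>

definition signed_op :: "nat \<Rightarrow> int set \<Rightarrow> int \<Rightarrow> int \<Rightarrow> int" where
  "signed_op p A i j = (if j \<in> A then j - i else i + j) mod int p"

lemma signed_op_closed: "p > 0 \<Longrightarrow> signed_op p A i j \<in> {0..<int p}"
  by (simp add: signed_op_def)

text \<open>The sign is governed by the right argument, hence \<open>\<beta>\<close> is the
  component that carries \<open>A\<close> to \<open>B\<close> or to its complement; the core lemma
  makes it affine.\<close>

lemma isotopic_signed_op_imp_affine:
  assumes p: "prime p" "odd p"
    and AB: "A \<subseteq> {0..<int p}" "B \<subseteq> {0..<int p}"
    and iso: "isotopic {0..<int p} (signed_op p A) {0..<int p} (signed_op p B)"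
  shows "\<exists>f\<in>Aff p. B = f ` A \<or> B = {0..<int p} - f ` A"
proof -
  let ?q = "int p" and ?Z = "{0..<int p}"
  obtain \<alpha> \<beta> \<gamma> where bij: "bij_betw \<alpha> ?Z ?Z" "bij_betw \<beta> ?Z ?Z" "bij_betw \<gamma> ?Z ?Z"
    and hom: "\<And>i j. i \<in> ?Z \<Longrightarrow> j \<in> ?Z \<Longrightarrow>
      signed_op p B (\<alpha> i) (\<beta> j) = \<gamma> (signed_op p A i j)"
    using iso unfolding isotopic_def by blast
  have q0: "?q > 0"
    using p(1) by (simp add: prime_gt_0_nat)
  have modZ: "x mod ?q \<in> ?Z" for x
    using q0 by simp
  have res_eq: "[x = y] (mod ?q) \<longleftrightarrow> x = y" if "x \<in> ?Z" "y \<in> ?Z" for x y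
    using that by (simp add: cong_def)
  have map: "\<alpha> i \<in> ?Z" "\<beta> i \<in> ?Z" "\<gamma> i \<in> ?Z" if "i \<in> ?Z" for i
    using that bij bij_betwE by blast+
  \<comment> \<open>Composing with reduction modulo \<open>p\<close> extends both maps to all
    integers, so that congruences can be used without range conditions.\<close>
  define g a where "g = (\<lambda>z. \<gamma> (z mod ?q))" and "a = (\<lambda>z. \<alpha> (z mod ?q))"
  define e d :: "int \<Rightarrow> int"
    where "e = (\<lambda>j. if j \<in> A then -1 else 1)" and "d = (\<lambda>j. if \<beta> j \<in> B then -1 else 1)"
  have eq: "[g (e j * i + j) = d j * a i + \<beta> j] (mod ?q)" if j: "j \<in> ?Z" for i j
  proof -
    have "signed_op p A (i mod ?q) j = (e j * i + j) mod ?q"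
      by (simp add: signed_op_def e_def mod_simps)
    moreover have "signed_op p B (a i) (\<beta> j) = (d j * a i + \<beta> j) mod ?q"
      by (simp add: signed_op_def d_def)
    ultimately have "g (e j * i + j) = (d j * a i + \<beta> j) mod ?q"
      using hom[OF modZ j, of i] by (simp add: g_def a_def)
    then show ?thesis
      by (simp add: cong_def)
  qed
  have g_iff: "[g x = g y] (mod ?q) \<longleftrightarrow> [x = y] (mod ?q)" for x y
  proof -
    have "[g x = g y] (mod ?q) \<longleftrightarrow> \<gamma> (x mod ?q) = \<gamma> (y mod ?q)"
      unfolding g_def by (rule res_eq) (rule map modZ)+
    also have "\<dots> \<longleftrightarrow> x mod ?q = y mod ?q"
      using bij(3) modZ by (metis bij_betw_def inj_onD)
    finally show ?thesis
      by (simp add: cong_def)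
  qed
  have g_surj: "\<exists>x. [g x = y] (mod ?q)" for y
  proof -
    obtain x where "x \<in> ?Z" "\<gamma> x = y mod ?q"
      using bij(3) modZ[of y] by (metis bij_betw_def imageE)
    then have "g x = y mod ?q"
      by (simp add: g_def)
    then show ?thesis
      by (intro exI[of _ x]) (simp add: cong_def)
  qed
  have b_inj: "j = k" if "j \<in> ?Z" "k \<in> ?Z" "[\<beta> j = \<beta> k] (mod ?q)" for j k
    using that bij(2) res_eq[OF map(2) map(2)] by (metis bij_betw_def inj_onD)
  have q: "prime ?q" "odd ?q"
    using p by auto
  note core = affine_of_signed_isotopy[OF q eq _ _ iffD2[OF g_iff] iffD1[OF g_iff] g_surj b_inj]
  have "\<exists>\<mu> t. \<not> ?q dvd \<mu> \<and> (\<forall>j\<in>?Z. [\<beta> j = \<mu> * j + t] (mod ?q))"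
    by (rule core(1)) (auto simp: e_def d_def)
  then obtain \<mu> t where \<mu>: "\<not> ?q dvd \<mu>" and \<beta>: "\<And>j. j \<in> ?Z \<Longrightarrow> [\<beta> j = \<mu> * j + t] (mod ?q)"
    by blast
  \<comment> \<open>Comparison with index 0 fixes the global sign: agreement at 0 gives the image of
    \<open>A\<close>, disagreement its complement.\<close>
  have sign: "e j * e 0 = d j * d 0" if "j \<in> ?Z" for j
    by (rule core(2)) (use that q0 in \<open>auto simp: e_def d_def\<close>)
  define f where "f = affine_map p \<mu> t"
  have "f j = \<beta> j" if "j \<in> ?Z" for j
    using \<beta>[OF that] map(2)[OF that] that by (simp add: f_def affine_map_apply cong_def)
  then have fA: "f ` A = \<beta> ` A"
    using AB(1) by (intro image_cong) auto
  have im: "\<beta> ` ?Z = ?Z" and inj: "inj_on \<beta> ?Z"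
    using bij(2) by (auto simp: bij_betw_def)
  have "B = \<beta> ` A \<or> B = ?Z - \<beta> ` A"
  proof (cases "e 0 = d 0")
    case True
    then have iff: "\<beta> j \<in> B \<longleftrightarrow> j \<in> A" if "j \<in> ?Z" for j
      using sign[OF that] by (auto simp: e_def d_def split: if_splits)
    have "B = \<beta> ` A"
    proof (intro equalityI subsetI)
      fix y assume y: "y \<in> B"
      then obtain j where "j \<in> ?Z" "y = \<beta> j"
        using AB(2) im by blast
      with y iff show "y \<in> \<beta> ` A" by blast
    qed (use iff AB(1) in blast)
    then show ?thesis ..
  next
    case False
    then have iff: "\<beta> j \<in> B \<longleftrightarrow> j \<notin> A" if "j \<in> ?Z" for j
      using sign[OF that] by (auto simp: e_def d_def split: if_splits)
    have "B = ?Z - \<beta> ` A"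
    proof (intro equalityI subsetI)
      fix y assume y: "y \<in> B"
      then obtain j where j: "j \<in> ?Z" "y = \<beta> j"
        using AB(2) im by blast
      then have "j \<notin> A"
        using y iff by blast
      then have "y \<notin> \<beta> ` A"
        using inj j AB(1) by (simp add: inj_on_image_mem_iff)
      with y AB(2) show "y \<in> ?Z - \<beta> ` A" by blast
    next
      fix y assume y: "y \<in> ?Z - \<beta> ` A"
      then obtain j where "j \<in> ?Z" "y = \<beta> j"
        using im by blast
      with y iff show "y \<in> B" by blast
    qed
    then show ?thesis ..
  qed
  moreover have "f \<in> Aff p"
    unfolding f_def using \<mu> q0 by (intro affine_map_in_Aff) auto
  ultimately show ?thesis
    unfolding fA[symmetric] by blast
qed

text \<open>The isotopy uses \<open>f\<close> for both \<open>\<beta>\<close> and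
  \<open>\<gamma>\<close>, and the linear part of \<open>f\<close> for \<open>\<alpha>\<close>,
  negated when a complement is taken.\<close>

lemma affine_imp_isotopic_signed_op:
  assumes p: "prime p" and A: "A \<subseteq> {0..<int p}"
    and f: "f \<in> Aff p" and B: "B = f ` A \<or> B = {0..<int p} - f ` A"
  shows "isotopic {0..<int p} (signed_op p A) {0..<int p} (signed_op p B)"
proof -
  let ?q = "int p" and ?Z = "{0..<int p}"
  have p0: "p > 0"
    using p by (simp add: prime_gt_0_nat)
  obtain \<mu> t where \<mu>: "\<not> ?q dvd \<mu>" and f_def: "f = affine_map p \<mu> t"
    using f by (rule Aff_cases)
  \<comment> \<open>Complementing flips every sign; negating the left argument undoes this.\<close>
  define \<epsilon> :: int where "\<epsilon> = (if B = f ` A then 1 else -1)"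
  define \<alpha> where "\<alpha> = affine_map p (\<epsilon> * \<mu>) 0"
  have "\<alpha> \<in> Aff p"
    unfolding \<alpha>_def using \<mu> p0 by (intro affine_map_in_Aff) (auto simp: \<epsilon>_def)
  then have bij: "bij_betw \<alpha> ?Z ?Z" "bij_betw f ?Z ?Z"
    using Aff_permutes[OF p] f permutes_imp_bij by blast+
  have mem: "f j \<in> f ` A \<longleftrightarrow> j \<in> A" "f j \<in> ?Z" if "j \<in> ?Z" for j
    using bij_betw_imp_inj_on[OF bij(2)] bij_betwE[OF bij(2)] that A
    by (simp_all add: inj_on_image_mem_iff)
  have "signed_op p B (\<alpha> i) (f j) = f (signed_op p A i j)" if ij: "i \<in> ?Z" "j \<in> ?Z" for i j
  proof -
    have 1: "f j = (\<mu> * j + t) mod ?q" "\<alpha> i = (\<epsilon> * \<mu> * i) mod ?q"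
      using ij by (simp_all add: f_def \<alpha>_def affine_map_apply)
    have 2: "f (signed_op p A i j) = (\<mu> * (if j \<in> A then j - i else i + j) + t) mod ?q"
      using p0 by (simp add: f_def affine_map_apply_mod signed_op_def)
    have "signed_op p B (\<alpha> i) (f j) = ((if f j \<in> B then -1 else 1) * \<alpha> i + f j) mod ?q"
      by (simp add: signed_op_def)
    also have "(if f j \<in> B then -1 else 1) = \<epsilon> * (if j \<in> A then -1 else 1)"
      using B mem[OF ij(2)] by (auto simp: \<epsilon>_def)
    also have "(\<epsilon> * (if j \<in> A then -1 else 1) * \<alpha> i + f j) mod ?q =
        (\<epsilon> * (if j \<in> A then -1 else 1) * (\<epsilon> * \<mu> * i) + (\<mu> * j + t)) mod ?q"
      unfolding 1 cong_def[symmetric] by (intro cong_add cong_mult cong_refl) simp_all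
    also have "\<epsilon> * (if j \<in> A then -1 else 1) * (\<epsilon> * \<mu> * i) + (\<mu> * j + t) =
        \<mu> * (if j \<in> A then j - i else i + j) + t"
      by (simp add: \<epsilon>_def algebra_simps)
    finally show ?thesis
      unfolding 2 .
  qed
  then show ?thesis
    unfolding isotopic_def using bij by blast
qed

lemma isotopic_signed_op_iff:
  assumes "prime p" "odd p" "A \<subseteq> {0..<int p}" "B \<subseteq> {0..<int p}"
  shows "isotopic {0..<int p} (signed_op p A) {0..<int p} (signed_op p B) \<longleftrightarrow>
     (\<exists>f\<in>Aff p. B = f ` A \<or> B = {0..<int p} - f ` A)"
  using isotopic_signed_op_imp_affine[OF assms]
    affine_imp_isotopic_signed_op[OF assms(1,3)] by blast

text \<open>Needed to compare residues with group elements, which \<open>equiv_nrt_isotopy\<close>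
  does not relate. Closure of \<open>f\<close> allows \<open>\<gamma>\<close> to be
  cancelled.\<close>

lemma isotopic_sym:
  assumes f: "\<And>x y. x \<in> S \<Longrightarrow> y \<in> S \<Longrightarrow> f x y \<in> S" and iso: "isotopic S f S' f'"
  shows "isotopic S' f' S f"
proof -
  obtain \<alpha> \<beta> \<gamma> where b: "bij_betw \<alpha> S S'" "bij_betw \<beta> S S'" "bij_betw \<gamma> S S'"
    and e: "\<And>x y. x \<in> S \<Longrightarrow> y \<in> S \<Longrightarrow> f' (\<alpha> x) (\<beta> y) = \<gamma> (f x y)"
    using iso unfolding isotopic_def by blast
  have "f (inv_into S \<alpha> x) (inv_into S \<beta> y) = inv_into S \<gamma> (f' x y)"
    if "x \<in> S'" "y \<in> S'" for x y
  proof -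
    have "inv_into S \<alpha> x \<in> S" "inv_into S \<beta> y \<in> S"
      using b that by (auto simp: bij_betw_def inv_into_into)
    then show ?thesis
      using e[of "inv_into S \<alpha> x" "inv_into S \<beta> y"] f b that
      by (simp add: bij_betw_inv_into_left bij_betw_inv_into_right)
  qed
  then show ?thesis
    using b[THEN bij_betw_inv_into] unfolding isotopic_def by blast
qed

lemma isotopic_trans:
  assumes "isotopic S f S' f'" "isotopic S' f' S'' f''"
  shows "isotopic S f S'' f''"
proof -
  obtain \<alpha> \<beta> \<gamma> \<alpha>' \<beta>' \<gamma>' where
      b: "bij_betw \<alpha> S S'" "bij_betw \<beta> S S'" "bij_betw \<gamma> S S'"
    and b': "bij_betw \<alpha>' S' S''" "bij_betw \<beta>' S' S''" "bij_betw \<gamma>' S' S''"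
    and e: "\<And>x y. x \<in> S \<Longrightarrow> y \<in> S \<Longrightarrow> f' (\<alpha> x) (\<beta> y) = \<gamma> (f x y)"
    and e': "\<And>x y. x \<in> S' \<Longrightarrow> y \<in> S' \<Longrightarrow> f'' (\<alpha>' x) (\<beta>' y) = \<gamma>' (f' x y)"
    using assms unfolding isotopic_def by auto
  have "f'' ((\<alpha>' \<circ> \<alpha>) x) ((\<beta>' \<circ> \<beta>) y) = (\<gamma>' \<circ> \<gamma>) (f x y)" if "x \<in> S" "y \<in> S" for x y
    using e e' b that by (simp add: bij_betw_apply)
  then show ?thesis
    using bij_betw_trans[OF b(1) b'(1)] bij_betw_trans[OF b(2) b'(2)]
      bij_betw_trans[OF b(3) b'(3)]
    unfolding isotopic_def by blast
qed

section \<open>Transversals in the dihedral group\<close>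

text \<open>\<open>Q\<close> is the pullback of \<open>R\<close> along the surjection
  \<open>h\<close>, which may identify points; taking preimages matches the classes.\<close>

lemma card_quotient_eq:
  assumes R: "equiv X R" and h: "h ` E = X" and Q: "Q \<subseteq> E \<times> E"
    and iff: "\<And>x y. x \<in> E \<Longrightarrow> y \<in> E \<Longrightarrow> (x, y) \<in> Q \<longleftrightarrow> (h x, h y) \<in> R"
  shows "card (E // Q) = card (X // R)"
proof -
  let ?F = "\<lambda>C. {x \<in> E. h x \<in> C}"
  have F: "?F (R `` {h x}) = Q `` {x}" if "x \<in> E" for x
    using that iff Q by auto
  have "X // R = (\<lambda>x. R `` {h x}) ` E"
    unfolding h[symmetric] quotient_def by blast
  then have "?F ` (X // R) = E // Q"
    unfolding quotient_def using F by (auto simp: image_image)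
  moreover have "inj_on ?F (X // R)"
  proof (rule inj_onI)
    fix C D assume CD: "C \<in> X // R" "D \<in> X // R" "?F C = ?F D"
    have "h ` ?F B = B" if "B \<in> X // R" for B
      using in_quotient_imp_subset[OF R that] h by auto
    with CD show "C = D" by metis
  qed
  ultimately show ?thesis
    by (metis card_image)
qed

text \<open>With \<open>y\<close> the nontrivial element of \<open>H\<close> and $x$ the rotation,
  \<open>e (i, False)\<close> is $x^i$ and \<open>e (i, True)\<close> is $y x^i$. Writing
  \<open>y\<close> on the left suits right cosets and makes the sign depend on the right
  factor.\<close>

lemma dihedral_coordinates:
  fixes G (structure)
  assumes p: "odd p" and G: "group G" "G \<cong> dihedral_group p"
    and H: "subgroup H G" "card H = 2"
  obtains e where "bij_betw e ({0..<int p} \<times> UNIV) (carrier G)"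
    and "e (0, False) = \<one>" and "H = {e (0, False), e (0, True)}"
    and "\<And>i s j t. i \<in> {0..<int p} \<Longrightarrow> j \<in> {0..<int p} \<Longrightarrow>
      e (i, s) \<otimes> e (j, t) = e ((if t then j - i else i + j) mod int p, s \<noteq> t)"
proof -
  interpret group G by fact
  let ?D = "dihedral_group p"
  have p0: "p > 0"
    using p by (rule odd_pos)
  interpret D: group ?D
    using p0 by (rule group_dihedral_group)
  obtain h where "h \<in> iso G ?D"
    using G(2) by (auto simp: is_iso_def)
  then obtain k where k: "k \<in> iso ?D G"
    using iso_set_sym by blast
  then have k_hom: "k \<in> hom ?D G" and k_bij: "bij_betw k (carrier ?D) (carrier G)"
    by (auto simp: iso_def)
  interpret k: group_hom ?D G k
    by (simp add: group_hom_def group_hom_axioms_def k_hom D.is_group is_group)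
  have k_mult: "k (a, s) \<otimes> k (b, t) = k ((if s then a - b else a + b) mod int p, s \<noteq> t)"
    if "a \<in> {0..<int p}" "b \<in> {0..<int p}" for a s b t
    using k.hom_mult[of "(a, s)" "(b, t)"] that by (simp add: dihedral_group_def)
  have k_one: "k (0, False) = \<one>"
    using k.hom_one by (simp add: dihedral_group_def)
  obtain y where y: "H = {\<one>, y}" "y \<noteq> \<one>"
  proof -
    obtain a b where ab: "H = {a, b}" "a \<noteq> b"
      using H(2) by (auto simp: card_2_iff)
    then show thesis
      using subgroup.one_closed[OF H(1)] that by blast
  qed
  have yG: "y \<in> carrier G"
    using subgroup.subset[OF H(1)] y by blast
  have "y \<otimes> y \<in> H"
    using subgroup.m_closed[OF H(1)] y by blast
  then have yy: "y \<otimes> y = \<one>"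
    using y yG by auto
  have "y \<in> k ` ({0..<int p} \<times> UNIV)"
    using yG bij_betw_imp_surj_on[OF k_bij] by (simp add: dihedral_group_def)
  then obtain c s where cs: "c \<in> {0..<int p}" "y = k (c, s)"
    by blast
  \<comment> \<open>A nontrivial rotation cannot be an involution, because \<open>p\<close> is odd;
    so \<open>y\<close> is a reflection.\<close>
  have s
  proof (rule ccontr)
    assume "\<not> s"
    then have "k ((c + c) mod int p, False) = k (0, False)"
      using yy k_one k_mult[OF cs(1) cs(1), of s s] cs(2) by simp
    then have "(c + c) mod int p = 0"
      using k_bij p0 by (auto simp: bij_betw_def dihedral_group_def inj_on_def)
    then have "int p dvd 2 * c"
      by (simp add: dvd_eq_mod_eq_0)
    then have "int p dvd c"
      using p by (simp add: coprime_dvd_mult_right_iff)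
    then have "c = 0"
      using cs(1) zdvd_not_zless by force
    then show False
      using \<open>\<not> s\<close> cs(2) k_one y(2) by simp
  qed
  \<comment> \<open>If \<open>y\<close> is $x^c$ times the standard reflection, then $y x^i$ is
    $x^{c-i}$ times it. The map \<open>r\<close> performs this change of form and is its own
    inverse.\<close>
  define r where "r = (\<lambda>(i, s). (if s then (c - i) mod int p else i, s))"
  define e where "e = k \<circ> r"
  have "bij_betw r ({0..<int p} \<times> UNIV) ({0..<int p} \<times> UNIV)"
    by (rule bij_betwI[where g = r]) (use p0 in \<open>auto simp: r_def mod_simps\<close>)
  moreover have D: "carrier ?D = {0..<int p} \<times> UNIV"
    by (simp add: dihedral_group_def)
  ultimately have "bij_betw e ({0..<int p} \<times> UNIV) (carrier G)"
    unfolding e_def using k_bij bij_betw_trans by metis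
  moreover have "e (0, False) = \<one>"
    by (simp add: e_def r_def k_one)
  moreover have "H = {e (0, False), e (0, True)}"
    using y \<open>s\<close> cs by (simp add: e_def r_def k_one)
  moreover have "e (i, s) \<otimes> e (j, t) = e ((if t then j - i else i + j) mod int p, s \<noteq> t)"
    if ij: "i \<in> {0..<int p}" "j \<in> {0..<int p}" for i s j t
  proof -
    have "(c - x) mod int p \<in> {0..<int p}" for x
      using p0 by simp
    moreover have "(i + (c - j) mod int p) mod int p = (c - (j - i) mod int p) mod int p"
      "((c - i) mod int p - j) mod int p = (c - (i + j) mod int p) mod int p"
      by (simp_all add: mod_simps algebra_simps)
    moreover have "((c - i) mod int p - (c - j) mod int p) mod int p = (j - i) mod int p"
      by (simp add: mod_diff_eq)
    ultimately show ?thesis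
      using ij by (cases s; cases t) (simp_all add: e_def r_def k_mult)
  qed
  ultimately show thesis
    by (rule that)
qed

section \<open>Transversals encoded by sets of residues\<close>

locale dihedral_transversals = group G for G (structure) +
  fixes p :: nat and H :: "'a set" and e :: "int \<times> bool \<Rightarrow> 'a"
  assumes p_pos: "p > 0"
    and e_bij: "bij_betw e ({0..<int p} \<times> UNIV) (carrier G)"
    and e_one: "e (0, False) = \<one>" and H_eq: "H = {e (0, False), e (0, True)}"
    and e_mult: "\<And>i s j t. i \<in> {0..<int p} \<Longrightarrow> j \<in> {0..<int p} \<Longrightarrow>
      e (i, s) \<otimes> e (j, t) = e ((if t then j - i else i + j) mod int p, s \<noteq> t)"
begin

definition transversal :: "int set \<Rightarrow> 'a set" where
  "transversal A = (\<lambda>i. e (i, i \<in> A)) ` {0..<int p}"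

lemma e_eq_iff:
  "i \<in> {0..<int p} \<Longrightarrow> j \<in> {0..<int p} \<Longrightarrow> e (i, s) = e (j, t) \<longleftrightarrow> i = j \<and> s = t"
  using inj_on_eq_iff[OF bij_betw_imp_inj_on[OF e_bij], of "(i, s)" "(j, t)"] by simp

lemma e_in_transversal:
  "i \<in> {0..<int p} \<Longrightarrow> e (i, s) \<in> transversal A \<longleftrightarrow> (s \<longleftrightarrow> i \<in> A)"
  by (auto simp: transversal_def e_eq_iff)

lemma coset_e: "i \<in> {0..<int p} \<Longrightarrow> H #> e (i, s) = {e (i, False), e (i, True)}"
  using p_pos by (cases s) (auto simp: r_coset_def H_eq e_mult)

lemma rcosets_e: "rcosets H = (\<lambda>i. {e (i, False), e (i, True)}) ` {0..<int p}"
proof -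
  have "carrier G = e ` ({0..<int p} \<times> UNIV)"
    using e_bij by (simp add: bij_betw_def)
  then show ?thesis
    by (auto simp: RCOSETS_def coset_e image_iff) (use coset_e in fastforce)
qed

text \<open>Each right coset is a pair \<open>{e (i, False), e (i, True)}\<close>, so a transversal
  is a binary choice at every residue; normalization settles the choice at 0.\<close>

lemma nrt_iff_transversal: "nrt G H S \<longleftrightarrow> (\<exists>A\<subseteq>{0..<int p}. 0 \<notin> A \<and> S = transversal A)"
proof
  assume S: "nrt G H S"
  then have sub: "S \<subseteq> carrier G" and one: "e (0, False) \<in> S"
    and uni: "\<And>i. i \<in> {0..<int p} \<Longrightarrow> \<exists>!x. x \<in> {e (i, False), e (i, True)} \<inter> S"
    by (auto simp: nrt_def rcosets_e e_one)
  have ex1: "e (i, False) \<in> S \<longleftrightarrow> e (i, True) \<notin> S" if "i \<in> {0..<int p}" for i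
    using uni[OF that] e_eq_iff[OF that that, of False True] by blast
  define A where "A = {i \<in> {0..<int p}. e (i, True) \<in> S}"
  have e_in: "e (i, s) \<in> S \<longleftrightarrow> e (i, s) \<in> transversal A" if "i \<in> {0..<int p}" for i s
    using ex1[OF that] that by (cases s) (simp_all add: e_in_transversal A_def)
  have coord: "\<exists>i s. i \<in> {0..<int p} \<and> x = e (i, s)" if "x \<in> S \<or> x \<in> transversal A" for x
  proof (cases "x \<in> S")
    case True
    then have "x \<in> e ` ({0..<int p} \<times> UNIV)"
      using sub e_bij by (auto simp: bij_betw_def)
    then show ?thesis by blast
  next
    case False
    with that show ?thesis
      unfolding transversal_def by blast
  qed
  have "S = transversal A"
  proof (rule Set.set_eqI)
    fix x
    show "x \<in> S \<longleftrightarrow> x \<in> transversal A"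
    proof (cases "x \<in> S \<or> x \<in> transversal A")
      case True
      then obtain i s where "i \<in> {0..<int p}" "x = e (i, s)"
        using coord by blast
      then show ?thesis
        using e_in by simp
    qed simp
  qed
  moreover have "0 \<notin> A"
    using one ex1[of 0] p_pos by (simp add: A_def)
  ultimately show "\<exists>A\<subseteq>{0..<int p}. 0 \<notin> A \<and> S = transversal A"
    by (intro exI[of _ A]) (auto simp: A_def)
next
  assume "\<exists>A\<subseteq>{0..<int p}. 0 \<notin> A \<and> S = transversal A"
  then obtain A where A: "0 \<notin> A" and S: "S = transversal A"
    by blast
  have "S \<subseteq> carrier G"
    using e_bij by (auto simp: S transversal_def bij_betw_def)
  moreover have "\<one> \<in> S"
    using A p_pos by (simp add: S e_in_transversal flip: e_one)
  moreover have "\<exists>!x. x \<in> {e (i, False), e (i, True)} \<inter> S" if "i \<in> {0..<int p}" for i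
    using that
    by (intro ex1I[of _ "e (i, i \<in> A)"]; cases "i \<in> A") (auto simp: S e_in_transversal)
  ultimately show "nrt G H S"
    by (auto simp: nrt_def rcosets_e)
qed

text \<open>Passing to the coset of \<open>H\<close> discards the flag of the product, and its
  residue depends only on the flag of the right factor.\<close>

lemma induced_op_transversal:
  assumes "i \<in> {0..<int p}" "j \<in> {0..<int p}"
  shows "induced_op G H (transversal A) (e (i, i \<in> A)) (e (j, j \<in> A)) =
    e (signed_op p A i j, signed_op p A i j \<in> A)"
proof -
  let ?k = "signed_op p A i j"
  have k: "?k \<in> {0..<int p}"
    using p_pos by (rule signed_op_closed)
  have "H #> (e (i, i \<in> A) \<otimes> e (j, j \<in> A)) = {e (?k, False), e (?k, True)}"
    using assms k by (simp add: e_mult coset_e signed_op_def)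
  moreover have "{e (?k, False), e (?k, True)} \<inter> transversal A = {e (?k, ?k \<in> A)}"
    using k by (cases "?k \<in> A") (simp_all add: e_in_transversal)
  ultimately show ?thesis
    by (simp add: induced_op_def)
qed

lemma isotopic_transversal:
  "isotopic {0..<int p} (signed_op p A) (transversal A) (induced_op G H (transversal A))"
proof -
  have "bij_betw (\<lambda>i. e (i, i \<in> A)) {0..<int p} (transversal A)"
    by (auto simp: bij_betw_def transversal_def e_eq_iff inj_on_def)
  then show ?thesis
    unfolding isotopic_def using induced_op_transversal by blast
qed

lemma isotopic_transversal_iff:
  "isotopic (transversal A) (induced_op G H (transversal A))
      (transversal B) (induced_op G H (transversal B)) \<longleftrightarrow>
    isotopic {0..<int p} (signed_op p A) {0..<int p} (signed_op p B)" (is "?L \<longleftrightarrow> ?R")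
proof
  have sym: "isotopic (transversal C) (induced_op G H (transversal C))
      {0..<int p} (signed_op p C)" for C
    by (rule isotopic_sym[OF _ isotopic_transversal]) (rule signed_op_closed[OF p_pos])
  show "?L \<Longrightarrow> ?R"
    using isotopic_trans isotopic_transversal sym by metis
  show "?R \<Longrightarrow> ?L"
    using isotopic_trans isotopic_transversal sym by metis
qed

text \<open>Orbits live on all subsets, transversals only on those without 0. The map
  \<open>N\<close> bridges the two: isotopy of transversals pulls back along it to the orbit
  relation.\<close>

lemma card_Itp:
  assumes p: "prime p" "odd p" and H: "subgroup H G"
  shows "card (Itp G H) =
    card (orbits (compl_group (Aff p)) (Pow {0..<int p}) (compl_act {0..<int p}))"
proof -
  let ?Z = "{0..<int p}" and ?K = "compl_group (Aff p)" and ?\<phi> = "compl_act {0..<int p}"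
  let ?iso = "\<lambda>A B. isotopic ?Z (signed_op p A) ?Z (signed_op p B)"
  \<comment> \<open>Of a set and its complement, the one avoiding 0; it lies in the same orbit,
    through the identity map with or without complementation.\<close>
  define N where "N = (\<lambda>A. if 0 \<in> A then ?Z - A else A)"
  define Q where "Q = {(A, B). A \<in> Pow ?Z \<and> B \<in> Group_Action.orbit ?K ?\<phi> A}"
  have N_sub: "N A \<subseteq> ?Z" "0 \<notin> N A" if "A \<subseteq> ?Z" for A
    using that by (auto simp: N_def)
  have nrt_N: "nrt G H (transversal (N A))" if "A \<subseteq> ?Z" for A
    unfolding nrt_iff_transversal using N_sub[OF that] by (intro exI[of _ "N A"]) simp
  have orbit: "B \<in> Group_Action.orbit ?K ?\<phi> A \<longleftrightarrow>
      (\<exists>f\<in>Aff p. B = f ` A \<or> B = ?Z - f ` A)" if "A \<subseteq> ?Z" for A B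
    using that
    by (auto simp: Group_Action.orbit_def compl_group_def compl_act_def UNIV_bool)
  have Q_iff: "(A, B) \<in> Q \<longleftrightarrow> ?iso A B" if "A \<subseteq> ?Z" "B \<subseteq> ?Z" for A B
    using that orbit isotopic_signed_op_iff[OF p that] by (simp add: Q_def)
  have iso_N: "?iso A (N A)" if "A \<subseteq> ?Z" for A
    unfolding isotopic_signed_op_iff[OF p that N_sub(1)[OF that]]
    using id_in_Aff[of p] prime_gt_1_nat[OF p(1)]
    by (intro bexI[of _ id]) (auto simp: N_def)
  have iso_N': "?iso (N A) A" if "A \<subseteq> ?Z" for A
    by (rule isotopic_sym[OF _ iso_N[OF that]]) (rule signed_op_closed[OF p_pos])
  have "orbits ?K (Pow ?Z) ?\<phi> = Pow ?Z // Q"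
    by (auto simp: orbits_def quotient_def Q_def)
  moreover have "card (Pow ?Z // Q) = card ({S. nrt G H S} // nrt_isotopy G H)"
  proof (rule card_quotient_eq[where h = "\<lambda>A. transversal (N A)"])
    show "equiv {S. nrt G H S} (nrt_isotopy G H)"
      using is_group H by (rule equiv_nrt_isotopy)
    show "(\<lambda>A. transversal (N A)) ` Pow ?Z = {S. nrt G H S}"
    proof (intro equalityI subsetI)
      fix S assume "S \<in> {S. nrt G H S}"
      then obtain A where "A \<subseteq> ?Z" "0 \<notin> A" "S = transversal A"
        by (auto simp: nrt_iff_transversal)
      then show "S \<in> (\<lambda>A. transversal (N A)) ` Pow ?Z"
        by (intro image_eqI[of _ _ A]) (auto simp: N_def)
    next
      fix S assume "S \<in> (\<lambda>A. transversal (N A)) ` Pow ?Z"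
      then show "S \<in> {S. nrt G H S}"
        using nrt_N by auto
    qed
    have image: "f ` A \<in> Pow ?Z" if "f \<in> Aff p" "A \<subseteq> ?Z" for f A
      using permutes_image[OF Aff_permutes[OF p(1) that(1)]] that(2) by blast
    show "Q \<subseteq> Pow ?Z \<times> Pow ?Z"
    proof (rule subrelI)
      fix A B assume "(A, B) \<in> Q"
      then have A: "A \<in> Pow ?Z" and "B \<in> Group_Action.orbit ?K ?\<phi> A"
        by (simp_all add: Q_def)
      then have "\<exists>f\<in>Aff p. B = f ` A \<or> B = ?Z - f ` A"
        using iffD1[OF orbit] by blast
      with A have "B \<in> Pow ?Z"
        using image by blast
      with A show "(A, B) \<in> Pow ?Z \<times> Pow ?Z" ..
    qed
    fix A B assume "A \<in> Pow ?Z" "B \<in> Pow ?Z"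
    then have AB: "A \<subseteq> ?Z" "B \<subseteq> ?Z" by auto
    have "(transversal (N A), transversal (N B)) \<in> nrt_isotopy G H \<longleftrightarrow> ?iso (N A) (N B)"
      using nrt_N AB by (simp add: nrt_isotopy_def isotopic_transversal_iff)
    also have "\<dots> \<longleftrightarrow> ?iso A B"
      using isotopic_trans iso_N iso_N' AB by metis
    finally show "(A, B) \<in> Q \<longleftrightarrow> (transversal (N A), transversal (N B)) \<in> nrt_isotopy G H"
      using Q_iff[OF AB] by simp
  qed
  ultimately show ?thesis
    by (simp add: Itp_def)
qed

end

theorem theorem3p9:
  fixes p :: nat and G :: "('a, 'b) monoid_scheme" and H :: "'a set"
  assumes "prime p" and "odd p"
    and "group G" and "G \<cong> dihedral_group p"
    and "subgroup H G" and "card H = 2"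
  shows "of_nat (card (Itp G H)) =
     eval_mpolynomial (\<lambda>_. 2) (cycle_index {0..<int p} (Aff p)) / 2"
proof -
  have p: "p > 0" "p > 1"
    using prime_gt_0_nat[OF assms(1)] prime_gt_1_nat[OF assms(1)] by auto
  obtain e where "dihedral_transversals G p H e"
    using dihedral_coordinates[OF assms(2-6)] assms(3) p(1)
    unfolding dihedral_transversals_def dihedral_transversals_axioms_def by metis
  then have "card (Itp G H) =
      card (orbits (compl_group (Aff p)) (Pow {0..<int p}) (compl_act {0..<int p}))"
    using assms(1,2,5) by (rule dihedral_transversals.card_Itp)
  moreover have "of_nat (card (orbits (compl_group (Aff p)) (Pow {0..<int p})
      (compl_act {0..<int p}))) =
      eval_mpolynomial (\<lambda>_. 2) (cycle_index {0..<int p} (Aff p)) / 2"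
    using assms(1,2) p Aff_permutes Aff_comp Aff_left_inverse id_in_Aff
    by (intro card_orbits_compl) auto
  ultimately show ?thesis
    by simp
qed

end
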